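(* Let $G$ be a nonbipartite triangle free graph of order $n\ge 2$ and let $k,\ell\geq 1$ be integers with $\max\{k,\ell\}\geq 2$. If $G$ is $C_5$-connected, then $$\dim_s(G\times K_{k,\ell})=n(k+\ell -1).$$
   Context: All graphs are finite and simple; $d_G(x,y)$ is the number of edges of a shortest $x$–$y$ path. A graph is $C_5$-connected if every pair of its vertices lies on a common five-cycle. $K_{k,\ell}$ is the complete bipartite graph with parts of sizes $k$ and $\ell$. In a connected graph $G$, a vertex $w$ strongly resolves two different vertices $u,v$ if $d_G(w,u)=d_G(w,v)+d_G(v,u)$ or $d_G(w,v)=d_G(w,u)+d_G(u,v)$. A set $S$ of vertices is a strong metric generator if every two different vertices are strongly resolved by some vertex of $S$; the strong metric dimension $\dim_s(G)$ is the smallest cardinality of a strong metric generator. The direct product $G\times H$ has vertex set $V(G)\times V(H)$, with $(g,h)\sim(g',h')$ iff $gg'\in E(G)$ and $hh'\in E(H)$. *)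

theory Defs
  imports "Graph_Theory.Graph_Theory"
begin

text \<open>
  Finite simple graphs are the structures satisfying \<^locale>\<open>pair_graph\<close>: an edge is represented
  by its two opposite arcs, so the edges on a walk are counted by the arcs of that walk.
\<close>

definition bipartite_graph :: "'a pair_pre_digraph \<Rightarrow> bool" where
  "bipartite_graph G \<longleftrightarrow> (\<exists>U V. pverts G = U \<union> V \<and> U \<inter> V = {} \<and> parcs G \<subseteq> U \<times> V \<union> V \<times> U)"

text \<open>
  The library's cycles include the closed walk of length 2 that runs through an edge and back,
  but those of length at least 3 are exactly the (rooted and oriented) cycles of the simple graph.
\<close>

definition triangle_free :: "'a pair_pre_digraph \<Rightarrow> bool" where
  "triangle_free G \<longleftrightarrow> \<not> (\<exists>p. pre_digraph.cycle (with_proj G) p \<and> length p = 3)"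

definition C5_connected :: "'a pair_pre_digraph \<Rightarrow> bool" where
  "C5_connected G \<longleftrightarrow>
    (\<forall>u\<in>pverts G. \<forall>v\<in>pverts G. u \<noteq> v \<longrightarrow>
      (\<exists>p. pre_digraph.cycle (with_proj G) p \<and> length p = 5 \<and> u \<in> fst ` set p \<and> v \<in> fst ` set p))"

text \<open>With unit weights, the weighted distance is the number of edges of a shortest path.\<close>

definition graph_dist :: "'a pair_pre_digraph \<Rightarrow> 'a \<Rightarrow> 'a \<Rightarrow> ereal" where
  "graph_dist G u v = wf_digraph.\<mu> (with_proj G) (\<lambda>_. 1) u v"

text \<open>
  The following three notions are meant for connected graphs only; in a disconnected graph some
  distances are infinite.
\<close>

definition strongly_resolves :: "'a pair_pre_digraph \<Rightarrow> 'a \<Rightarrow> 'a \<Rightarrow> 'a \<Rightarrow> bool" where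
  "strongly_resolves G w u v \<longleftrightarrow>
    graph_dist G w u = graph_dist G w v + graph_dist G v u \<or>
    graph_dist G w v = graph_dist G w u + graph_dist G u v"

definition strong_metric_generator :: "'a pair_pre_digraph \<Rightarrow> 'a set \<Rightarrow> bool" where
  "strong_metric_generator G S \<longleftrightarrow> S \<subseteq> pverts G \<and>
    (\<forall>u\<in>pverts G. \<forall>v\<in>pverts G. u \<noteq> v \<longrightarrow> (\<exists>w\<in>S. strongly_resolves G w u v))"

definition strong_metric_dim :: "'a pair_pre_digraph \<Rightarrow> nat" where
  "strong_metric_dim G = (LEAST m. \<exists>S. strong_metric_generator G S \<and> card S = m)"

definition direct_product ::
  "'a pair_pre_digraph \<Rightarrow> 'b pair_pre_digraph \<Rightarrow> ('a \<times> 'b) pair_pre_digraph" where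
  "direct_product G H =
    \<lparr> pverts = pverts G \<times> pverts H,
      parcs = {((g, h), (g', h')) | g h g' h'. (g, g') \<in> parcs G \<and> (h, h') \<in> parcs H} \<rparr>"

end

theory Submission
  imports Defs
begin

text \<open>
  A walk in a direct product is a pair of walks of equal length in the factors. Between two vertices
  of a complete bipartite graph with sides \<open>A\<close> and \<open>B\<close> there are walks of every positive length whose
  parity fits the sides, and of no other positive length. A distance in the product is therefore the
  least length of a walk in \<open>G\<close> of prescribed parity, except that length \<open>0\<close> also requires
  equal second coordinates. Pentagons provide short walks of either parity, and the absence of
  loops and triangles excludes shorter ones. So the distance depends only on whether the first
  coordinates are equal, adjacent or neither, on whether the second coordinates lie on the same
  side, and on whether the two vertices coincide (\<open>graph_dist_P\<close>); no distance exceeds \<open>5\<close>.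

  Lower bound: two different vertices \<open>(g, h)\<close> and \<open>(g, h')\<close> over the same \<open>g\<close> are strongly
  resolved by themselves only. If \<open>h\<close> and \<open>h'\<close> are on opposite sides, their distance is
  the diameter \<open>5\<close>, so no shortest path between them extends; if they are on the same side, every
  other vertex has the same distance to both. Hence a strong metric generator contains all but at
  most one vertex of each of the \<open>n\<close> copies of the bipartite graph
  (\<open>generator_misses_at_most_one\<close>).

  Upper bound: leaving out the same vertex \<open>h0\<close> from every copy yields a strong metric generator
  (\<open>generator_without_layer\<close>), since every shortest path between \<open>(g, h0)\<close> and \<open>(g', h0)\<close> with
  \<open>g \<noteq> g'\<close> extends by one step beyond an end, to a vertex on the side opposite to \<open>h0\<close>.
\<close>

section \<open>Distances as least walk lengths\<close>

lemma (in pair_wf_digraph) ex_awalk_of_length_iff: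
  "(\<exists>p. awalk u p v \<and> length p = n) \<longleftrightarrow> u \<in> pverts G \<and> (u, v) \<in> parcs G ^^ n"
proof (induction n arbitrary: u)
  case 0
  show ?case by (auto simp: awalk_Nil_iff)
next
  case (Suc n)
  have "(\<exists>p. awalk u p v \<and> length p = Suc n)
      \<longleftrightarrow> (\<exists>w. (u, w) \<in> parcs G \<and> (\<exists>p. awalk w p v \<and> length p = n))"
  proof (intro iffI; elim exE conjE)
    fix p assume "awalk u p v" "length p = Suc n"
    then obtain e q where "p = e # q" "length q = n"
      by (cases p) auto
    with \<open>awalk u p v\<close> show "\<exists>w. (u, w) \<in> parcs G \<and> (\<exists>p. awalk w p v \<and> length p = n)"
      by (intro exI[of _ "snd e"] conjI exI[of _ q]) (simp_all add: awalk_Cons_iff)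
  next
    fix w p assume "(u, w) \<in> parcs G" "awalk w p v" "length p = n"
    then show "\<exists>p. awalk u p v \<and> length p = Suc n"
      by (intro exI[of _ "(u, w) # p"]) (simp add: awalk_Cons_iff)
  qed
  also have "\<dots> \<longleftrightarrow> u \<in> pverts G \<and> (u, v) \<in> parcs G O parcs G ^^ n"
    unfolding Suc.IH relcomp_unfold using wellformed' by blast
  also have "parcs G O parcs G ^^ n = parcs G ^^ Suc n"
    by (simp add: relpow_commute)
  finally show ?case .
qed

lemma (in pair_wf_digraph) graph_dist_eqI:
  assumes "u \<in> pverts G" and "(u, v) \<in> parcs G ^^ m"
    and "\<And>j. (u, v) \<in> parcs G ^^ j \<Longrightarrow> m \<le> j"
  shows "graph_dist G u v = ereal (real m)"
proof -
  have cost: "awalk_cost (\<lambda>_. 1) p = real (length p)" for p :: "('a \<times> 'a) list"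
    by (induction p) auto
  show ?thesis
    unfolding graph_dist_def \<mu>_def
  proof (rule antisym)
    from assms(1,2) obtain p where "awalk u p v" "length p = m"
      using ex_awalk_of_length_iff by blast
    then show "(INF p\<in>{p. awalk u p v}. ereal (awalk_cost (\<lambda>_. 1) p)) \<le> ereal (real m)"
      by (intro INF_lower2[of p]) (auto simp: cost)
  next
    have "m \<le> length p" if "awalk u p v" for p
      using that assms(3) ex_awalk_of_length_iff by blast
    then show "ereal (real m) \<le> (INF p\<in>{p. awalk u p v}. ereal (awalk_cost (\<lambda>_. 1) p))"
      by (intro INF_greatest) (auto simp: cost)
  qed
qed

lemma relpow_direct_product:
  "((g, h), (g', h')) \<in> parcs (direct_product G H) ^^ n
    \<longleftrightarrow> (g, g') \<in> parcs G ^^ n \<and> (h, h') \<in> parcs H ^^ n"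
proof (induction n arbitrary: g' h')
  case 0
  show ?case by auto
next
  case (Suc n)
  have arc: "((a, b), (a', b')) \<in> parcs (direct_product G H)
      \<longleftrightarrow> (a, a') \<in> parcs G \<and> (b, b') \<in> parcs H" for a b a' b'
    by (auto simp: direct_product_def)
  show ?case
    by (auto simp: relcomp_unfold Suc.IH arc)
qed

text \<open>
  Every step changes sides, which forces the parity. Conversely, a walk can be prolonged by one step
  to any vertex of the side that it does not end on, and never gets stuck as both sides are nonempty.
\<close>

lemma relpow_complete_bipartite:
  assumes "A \<inter> B = {}" and "A \<noteq> {}" and "B \<noteq> {}" and "h \<in> A \<union> B" and "h' \<in> A \<union> B"
  shows "(h, h') \<in> (A \<times> B \<union> B \<times> A) ^^ j
    \<longleftrightarrow> (if j = 0 then h = h' else even j \<longleftrightarrow> (h \<in> A \<longleftrightarrow> h' \<in> A))"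
  using assms(5)
proof (induction j arbitrary: h')
  case 0
  show ?case by simp
next
  case (Suc j)
  have "(h, h') \<in> (A \<times> B \<union> B \<times> A) ^^ Suc j
      \<longleftrightarrow> (\<exists>x\<in>A \<union> B. (h, x) \<in> (A \<times> B \<union> B \<times> A) ^^ j \<and> (x, h') \<in> A \<times> B \<union> B \<times> A)"
    by auto
  also have "\<dots> \<longleftrightarrow> (\<exists>x\<in>A \<union> B. (if j = 0 then h = x else even j \<longleftrightarrow> (h \<in> A \<longleftrightarrow> x \<in> A))
      \<and> (x, h') \<in> A \<times> B \<union> B \<times> A)"
    using Suc.IH by blast
  also have "\<dots> \<longleftrightarrow> (\<exists>x\<in>A \<union> B. (if j = 0 then h = x else even j \<longleftrightarrow> (h \<in> A \<longleftrightarrow> x \<in> A))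
      \<and> (x \<in> A \<longleftrightarrow> h' \<notin> A))"
  proof (rule bex_cong[OF refl])
    fix x assume "x \<in> A \<union> B"
    then have "(x, h') \<in> A \<times> B \<union> B \<times> A \<longleftrightarrow> (x \<in> A \<longleftrightarrow> h' \<notin> A)"
      using assms(1) Suc.prems by blast
    then show "(if j = 0 then h = x else even j \<longleftrightarrow> (h \<in> A \<longleftrightarrow> x \<in> A))
        \<and> (x, h') \<in> A \<times> B \<union> B \<times> A \<longleftrightarrow>
      (if j = 0 then h = x else even j \<longleftrightarrow> (h \<in> A \<longleftrightarrow> x \<in> A)) \<and> (x \<in> A \<longleftrightarrow> h' \<notin> A)"
      by (simp only:)
  qed
  also have "\<dots> \<longleftrightarrow> (even (Suc j) \<longleftrightarrow> (h \<in> A \<longleftrightarrow> h' \<in> A))"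
  proof (cases "j = 0")
    case True
    with assms(4) show ?thesis by auto
  next
    case False
    have "\<exists>x\<in>A \<union> B. x \<in> A \<longleftrightarrow> h' \<notin> A"
      using assms(1-3) by blast
    with False show ?thesis by (cases "even j") auto
  qed
  finally show ?case by simp
qed

section \<open>Triangle-free graphs whose vertices share pentagons\<close>

text \<open>
  In a graph with a single vertex, being \<^term>\<open>C5_connected\<close> is vacuous. Asking for two vertices puts
  every vertex on a pentagon.
\<close>

locale pentagonal_graph = pair_graph G for G :: "'a pair_pre_digraph" +
  assumes triangle_free: "triangle_free G"
    and C5_connected: "C5_connected G"
    and two_vertices: "2 \<le> card (pverts G)"
begin

lemma arc_sym: "(u, v) \<in> parcs G \<Longrightarrow> (v, u) \<in> parcs G"
  using pair_sym_arcs symD[of "parcs G" u v] by (simp add: symmetric_def)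

lemma no_loop: "(u, u) \<notin> parcs G"
  using pair_no_loops by fastforce

lemma no_triangle:
  assumes "(u, v) \<in> parcs G" "(v, w) \<in> parcs G"
  shows "(w, u) \<notin> parcs G"
proof
  assume wu: "(w, u) \<in> parcs G"
  have "cycle [(u, v), (v, w), (w, u)]"
    unfolding cycle_def using assms wu no_loop
    by (intro exI[of _ u]) (auto simp: awalk_def dest: wellformed')
  with triangle_free show False
    unfolding triangle_free_def by auto
qed

text \<open>
  Two vertices of a pentagon are one or two steps apart on it, in one of its two directions.
\<close>

lemma pentagon_cases:
  assumes "u \<in> pverts G" "v \<in> pverts G" "u \<noteq> v"
  obtains (adjacent) a b c where
      "(u, v) \<in> parcs G" "(v, a) \<in> parcs G" "(a, b) \<in> parcs G" "(b, c) \<in> parcs G"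
      "(c, u) \<in> parcs G"
    | (opposite) a b c where
      "(u, a) \<in> parcs G" "(a, v) \<in> parcs G" "(v, b) \<in> parcs G" "(b, c) \<in> parcs G"
      "(c, u) \<in> parcs G"
proof -
  from assms C5_connected obtain p where p: "cycle p" "length p = 5"
      "u \<in> fst ` set p" "v \<in> fst ` set p"
    unfolding C5_connected_def by blast
  then obtain x0 y0 x1 y1 x2 y2 x3 y3 x4 y4 where
    p_eq: "p = [(x0, y0), (x1, y1), (x2, y2), (x3, y3), (x4, y4)]"
    by (auto simp: length_Suc_conv numeral_eq_Suc)
  have arcs: "(x0, x1) \<in> parcs G" "(x1, x2) \<in> parcs G" "(x2, x3) \<in> parcs G"
      "(x3, x4) \<in> parcs G" "(x4, x0) \<in> parcs G"
    using p(1) by (auto simp: p_eq cycle_def awalk_def)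
  have uv: "u \<in> {x0, x1, x2, x3, x4}" "v \<in> {x0, x1, x2, x3, x4}"
    using p(3,4) by (simp_all add: p_eq)
  (* P lists the vertices of a pentagon in order; rotating it makes u the first of them. *)
  define P where "P a b c d e \<longleftrightarrow> (a, b) \<in> parcs G \<and> (b, c) \<in> parcs G \<and> (c, d) \<in> parcs G
      \<and> (d, e) \<in> parcs G \<and> (e, a) \<in> parcs G" for a b c d e
  have P: "P x0 x1 x2 x3 x4"
    using arcs by (simp add: P_def)
  obtain a b c d where Pu: "P u a b c d" and rotated: "{x0, x1, x2, x3, x4} = {u, a, b, c, d}"
  proof -
    from uv(1) consider "u = x0" | "u = x1" | "u = x2" | "u = x3" | "u = x4"
      by blast
    then show thesis
    proof cases
      case 1 with P show thesis by (intro that[of x1 x2 x3 x4]) (simp_all add: P_def insert_commute)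
    next
      case 2 with P show thesis by (intro that[of x2 x3 x4 x0]) (simp_all add: P_def insert_commute)
    next
      case 3 with P show thesis by (intro that[of x3 x4 x0 x1]) (simp_all add: P_def insert_commute)
    next
      case 4 with P show thesis by (intro that[of x4 x0 x1 x2]) (simp_all add: P_def insert_commute)
    next
      case 5 with P show thesis by (intro that[of x0 x1 x2 x3]) (simp_all add: P_def insert_commute)
    qed
  qed
  from uv(2) assms(3) consider "v = a" | "v = b" | "v = c" | "v = d"
    unfolding rotated by blast
  then show thesis
  proof cases
    case 1 with Pu show thesis by (intro adjacent[of b c d]) (simp_all add: P_def)
  next
    case 2 with Pu show thesis by (intro opposite[of a c d]) (simp_all add: P_def)
  next
    case 3 with Pu show thesis by (intro opposite[of d b a]) (simp_all add: P_def arc_sym)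
  next
    case 4 with Pu show thesis by (intro adjacent[of c b a]) (simp_all add: P_def arc_sym)
  qed
qed

lemma ex_neighbour:
  assumes "u \<in> pverts G"
  obtains v where "(u, v) \<in> parcs G"
proof -
  have "pverts G \<noteq> {u}"
    using two_vertices by auto
  with assms obtain v where "v \<in> pverts G" "u \<noteq> v"
    by blast
  with assms show thesis
    by (rule pentagon_cases) (auto intro: that)
qed

text \<open>
  The next lemmas determine, for each parity, the least length of a walk between two vertices. A walk
  of length \<open>2\<close> between adjacent vertices would close to a triangle, and so would a closed walk of
  length \<open>3\<close>. The walks that do exist run along pentagons.
\<close>

lemma no_walk_2:
  assumes "(u, v) \<in> parcs G"
  shows "(u, v) \<notin> parcs G ^^ 2"
  using no_triangle[of u _ v] arc_sym[OF assms] by (auto simp: numeral_2_eq_2)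

lemma no_walk_3: "(u, u) \<notin> parcs G ^^ 3"
proof
  assume "(u, u) \<in> parcs G ^^ 3"
  then have "(u, u) \<in> (parcs G O parcs G) O parcs G"
    by (simp add: numeral_3_eq_3)
  then obtain a b where "(u, a) \<in> parcs G" "(a, b) \<in> parcs G" "(b, u) \<in> parcs G"
    by (elim relcompE Pair_inject) simp
  with no_triangle[of u a b] show False by simp
qed

lemma walk_4:
  assumes "(u, v) \<in> parcs G"
  shows "(u, v) \<in> parcs G ^^ 4"
proof -
  from assms have "v \<in> pverts G" "u \<in> pverts G" "v \<noteq> u"
    using wellformed' no_loop by auto
  (* The edge completes this walk to a pentagon. *)
  then obtain a b c where "(u, a) \<in> parcs G" "(a, b) \<in> parcs G" "(b, c) \<in> parcs G"
      "(c, v) \<in> parcs G"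
  proof (cases rule: pentagon_cases)
    case (adjacent a b c)
    with that show thesis by blast
  next
    case (opposite a b c)
    with assms no_triangle[of u v a] show thesis by simp
  qed
  then have "(u, v) \<in> ((parcs G O parcs G) O parcs G) O parcs G"
    by blast
  then show ?thesis
    by (simp add: numeral_eq_Suc)
qed

lemma opposite_vertices:
  assumes "u \<in> pverts G" "v \<in> pverts G" "u \<noteq> v" "(u, v) \<notin> parcs G"
  obtains a b c where "(u, a) \<in> parcs G" "(a, v) \<in> parcs G" "(v, b) \<in> parcs G"
    "(b, c) \<in> parcs G" "(c, u) \<in> parcs G"
  using assms(1-3) by (rule pentagon_cases) (use assms(4) that in blast)+

lemma walk_2:
  assumes "u \<in> pverts G" "v \<in> pverts G" "(u, v) \<notin> parcs G"
  shows "(u, v) \<in> parcs G ^^ 2"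
proof (cases "u = v")
  case True
  from assms(1) obtain a where "(u, a) \<in> parcs G"
    by (rule ex_neighbour)
  with True arc_sym[OF this] show ?thesis
    by (auto simp: numeral_2_eq_2)
next
  case False
  with assms obtain a where "(u, a) \<in> parcs G" "(a, v) \<in> parcs G"
    using opposite_vertices by metis
  then show ?thesis
    by (auto simp: numeral_2_eq_2)
qed

lemma walk_3:
  assumes "u \<in> pverts G" "v \<in> pverts G" "u \<noteq> v" "(u, v) \<notin> parcs G"
  shows "(u, v) \<in> parcs G ^^ 3"
proof -
  from assms obtain b c where "(v, b) \<in> parcs G" "(b, c) \<in> parcs G" "(c, u) \<in> parcs G"
    using opposite_vertices by metis
  note this[THEN arc_sym]
  then have "(u, v) \<in> (parcs G O parcs G) O parcs G"
    by blast
  then show ?thesis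
    by (simp add: numeral_3_eq_3)
qed

lemma walk_5:
  assumes "u \<in> pverts G"
  shows "(u, u) \<in> parcs G ^^ 5"
proof -
  from assms obtain v where uv: "(u, v) \<in> parcs G"
    by (rule ex_neighbour)
  from relpow_Suc_I2[OF uv walk_4[OF arc_sym[OF uv]]] show ?thesis
    by (simp only: Suc_numeral numeral_plus_one semiring_norm)
qed

end

section \<open>Distances in the product with a complete bipartite graph\<close>

locale pentagonal_product = pentagonal_graph G for G :: "'a pair_pre_digraph" +
  fixes H :: "'b pair_pre_digraph" and A B :: "'b set"
  assumes finite_sides: "finite A" "finite B"
    and disjoint_sides: "A \<inter> B = {}"
    and nonempty_sides: "A \<noteq> {}" "B \<noteq> {}"
    and pverts_H: "pverts H = A \<union> B"
    and parcs_H: "parcs H = A \<times> B \<union> B \<times> A"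
begin

abbreviation "P \<equiv> direct_product G H"

lemma pverts_P: "pverts P = pverts G \<times> (A \<union> B)"
  by (simp add: direct_product_def pverts_H)

lemma wf_P: "pair_wf_digraph P"
  by unfold_locales (auto simp: direct_product_def pverts_H parcs_H dest: wellformed')

lemma graph_dist_P_eqI:
  assumes "g \<in> pverts G" "h \<in> A \<union> B" "h' \<in> A \<union> B"
    and "(g, g') \<in> parcs G ^^ m" "if m = 0 then h = h' else even m \<longleftrightarrow> (h \<in> A \<longleftrightarrow> h' \<in> A)"
    and "\<And>j. (g, g') \<in> parcs G ^^ j \<Longrightarrow>
      if j = 0 then h = h' else even j \<longleftrightarrow> (h \<in> A \<longleftrightarrow> h' \<in> A) \<Longrightarrow> m \<le> j"
  shows "graph_dist P (g, h) (g', h') = ereal (real m)"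
proof -
  interpret P: pair_wf_digraph P
    by (rule wf_P)
  note walks = relpow_direct_product parcs_H
    relpow_complete_bipartite[OF disjoint_sides nonempty_sides assms(2,3)]
  show ?thesis
    using assms by (intro P.graph_dist_eqI) (auto simp only: walks pverts_P mem_Sigma_iff)
qed

text \<open>
  The entry \<open>4\<close> is the long way around a pentagon through the edge, \<open>2\<close> and \<open>3\<close> are the two ways
  around a pentagon between nonadjacent vertices, and \<open>5\<close> is a full turn. The entry \<open>2\<close> also arises
  from a step to a neighbour and back.
\<close>

lemma graph_dist_P:
  assumes "g \<in> pverts G" "g' \<in> pverts G" "h \<in> A \<union> B" "h' \<in> A \<union> B"
  shows "graph_dist P (g, h) (g', h') =
    (if h \<in> A \<longleftrightarrow> h' \<in> A then
       if g = g' \<and> h = h' then 0 else if (g, g') \<in> parcs G then 4 else 2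
     else if (g, g') \<in> parcs G then 1 else if g = g' then 5 else 3)"
proof -
  note eqI = graph_dist_P_eqI[OF assms(1,3,4)]
  have no_walk_1: "j \<noteq> 1" if "(g, g') \<in> parcs G ^^ j" "(g, g') \<notin> parcs G" for j
    using that by auto
  consider (refl) "g = g'" "h = h'"
    | (even_adjacent) "h \<in> A \<longleftrightarrow> h' \<in> A" "(g, g') \<in> parcs G"
    | (even) "h \<in> A \<longleftrightarrow> h' \<in> A" "(g, g') \<notin> parcs G" "\<not> (g = g' \<and> h = h')"
    | (odd_adjacent) "\<not> (h \<in> A \<longleftrightarrow> h' \<in> A)" "(g, g') \<in> parcs G"
    | (odd_equal) "\<not> (h \<in> A \<longleftrightarrow> h' \<in> A)" "g = g'"
    | (odd) "\<not> (h \<in> A \<longleftrightarrow> h' \<in> A)" "(g, g') \<notin> parcs G" "g \<noteq> g'"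
    by blast
  then show ?thesis
  proof cases
    case refl
    then have "graph_dist P (g, h) (g', h') = ereal (real 0)"
      by (intro eqI) auto
    with refl show ?thesis by simp
  next
    case even_adjacent
    have "graph_dist P (g, h) (g', h') = ereal (real 4)"
    proof (rule eqI)
      fix j assume j: "(g, g') \<in> parcs G ^^ j"
        "if j = 0 then h = h' else even j \<longleftrightarrow> (h \<in> A \<longleftrightarrow> h' \<in> A)"
      have "even j" "j \<noteq> 0" "j \<noteq> 2"
        using j even_adjacent no_loop no_walk_2 by (auto split: if_splits)
      then show "4 \<le> j" by presburger
    qed (use even_adjacent walk_4 in simp_all)
    with even_adjacent no_loop show ?thesis by auto
  next
    case even
    have "graph_dist P (g, h) (g', h') = ereal (real 2)"
    proof (rule eqI)
      fix j assume j: "(g, g') \<in> parcs G ^^ j"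
        "if j = 0 then h = h' else even j \<longleftrightarrow> (h \<in> A \<longleftrightarrow> h' \<in> A)"
      have "even j" "j \<noteq> 0"
        using j even by (auto split: if_splits)
      then show "2 \<le> j" by presburger
    qed (use even walk_2 assms in simp_all)
    with even show ?thesis by auto
  next
    case odd_adjacent
    have "graph_dist P (g, h) (g', h') = ereal (real 1)"
    proof (rule eqI)
      fix j :: nat assume j: "if j = 0 then h = h' else even j \<longleftrightarrow> (h \<in> A \<longleftrightarrow> h' \<in> A)"
      with odd_adjacent show "1 \<le> j" by (auto split: if_splits)
    qed (use odd_adjacent in simp_all)
    with odd_adjacent show ?thesis by auto
  next
    case odd_equal
    have "graph_dist P (g, h) (g', h') = ereal (real 5)"
    proof (rule eqI)
      fix j assume j: "(g, g') \<in> parcs G ^^ j"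
        "if j = 0 then h = h' else even j \<longleftrightarrow> (h \<in> A \<longleftrightarrow> h' \<in> A)"
      have "odd j" "j \<noteq> 1" "j \<noteq> 3"
        using j odd_equal no_walk_1[OF j(1)] no_loop no_walk_3 by (auto split: if_splits)
      then show "5 \<le> j" by presburger
    qed (use odd_equal walk_5 assms in simp_all)
    with odd_equal no_loop show ?thesis by auto
  next
    case odd
    have "graph_dist P (g, h) (g', h') = ereal (real 3)"
    proof (rule eqI)
      fix j assume j: "(g, g') \<in> parcs G ^^ j"
        "if j = 0 then h = h' else even j \<longleftrightarrow> (h \<in> A \<longleftrightarrow> h' \<in> A)"
      have "odd j" "j \<noteq> 1"
        using j odd no_walk_1[OF j(1)] by (auto split: if_splits)
      then show "3 \<le> j" by presburger
    qed (use odd walk_3 assms in simp_all)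
    with odd show ?thesis by auto
  qed
qed

section \<open>Strong metric generators of the product\<close>

text \<open>
  Second coordinates on the same side give \<open>(g, h)\<close> and \<open>(g, h')\<close> the same neighbours, so a third
  vertex has equal distances to them and cannot resolve them. On opposite sides they are at
  distance \<open>5\<close>, and a third vertex that resolved them would be farther than \<open>5\<close> from one of them.
\<close>

lemma generator_misses_at_most_one:
  assumes S: "strong_metric_generator P S" and "g \<in> pverts G"
    and "h \<in> A \<union> B" "h' \<in> A \<union> B" "(g, h) \<notin> S" "(g, h') \<notin> S"
  shows "h = h'"
proof (rule ccontr)
  assume "h \<noteq> h'"
  with assms obtain x y where w: "(x, y) \<in> S" "strongly_resolves P (x, y) (g, h) (g, h')"
    unfolding strong_metric_generator_def pverts_P by fastforce
  with S have xy: "x \<in> pverts G" "y \<in> A \<union> B"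
    by (auto simp: strong_metric_generator_def pverts_P)
  have "(x, y) \<noteq> (g, h)" "(x, y) \<noteq> (g, h')"
    using w(1) assms(5,6) by auto
  with w(2) \<open>h \<noteq> h'\<close> show False
    unfolding strongly_resolves_def
      graph_dist_P[OF xy(1) assms(2) xy(2) assms(3)] graph_dist_P[OF xy(1) assms(2) xy(2) assms(4)]
      graph_dist_P[OF assms(2,2,3,4)] graph_dist_P[OF assms(2,2,4,3)]
    by (auto simp: no_loop split: if_splits)
qed

lemma generator_card_ge:
  assumes S: "strong_metric_generator P S"
  shows "card (pverts G) * (card (A \<union> B) - 1) \<le> card S"
proof -
  (* The part of S in the copy of H over g. *)
  define F where "F g = {h \<in> A \<union> B. (g, h) \<in> S}" for g
  have fin: "finite (A \<union> B)"
    using finite_sides by simp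
  have fin_F: "finite (F g)" for g
    using fin by (rule rev_finite_subset) (auto simp: F_def)
  have F: "card (A \<union> B) - 1 \<le> card (F g)" if "g \<in> pverts G" for g
  proof -
    have "card (A \<union> B - F g) \<le> Suc 0"
      using generator_misses_at_most_one[OF S that] fin
      by (subst card_le_Suc0_iff_eq) (auto simp: F_def)
    moreover have "card (A \<union> B - F g) = card (A \<union> B) - card (F g)"
      using fin by (intro card_Diff_subset) (auto simp: F_def)
    ultimately show ?thesis by simp
  qed
  have "S = Sigma (pverts G) F"
    using S by (auto simp: F_def strong_metric_generator_def pverts_P)
  then have "card S = (\<Sum>g\<in>pverts G. card (F g))"
    using pair_finite_verts fin_F by simp
  also have "\<dots> \<ge> card (pverts G) * (card (A \<union> B) - 1)"
    using sum_bounded_below[of "pverts G" "card (A \<union> B) - 1" "\<lambda>g. card (F g)"] F by simp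
  finally show ?thesis .
qed

text \<open>
  The pairs to resolve are \<open>(g, h0)\<close> and \<open>(g', h0)\<close>. If \<open>g\<close> and \<open>g'\<close> are adjacent, their
  distance \<open>4\<close> extends to a distance \<open>5\<close> within the copy over \<open>g\<close>. Otherwise a pentagon with
  consecutive vertices \<open>g'\<close>, \<open>b\<close>, \<open>c\<close>, \<open>g\<close> provides a neighbour \<open>b\<close> of \<open>g'\<close> that is not
  adjacent to \<open>g\<close>, and the distance \<open>2\<close> extends to \<open>3\<close>.
\<close>

lemma generator_without_layer:
  assumes "h0 \<in> A"
  shows "strong_metric_generator P (pverts G \<times> (A \<union> B - {h0}))" (is "strong_metric_generator P ?S")
  unfolding strong_metric_generator_def
proof (intro conjI ballI impI)
  show "?S \<subseteq> pverts P"
    by (auto simp: pverts_P)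
next
  fix u v assume uv: "u \<in> pverts P" "v \<in> pverts P" "u \<noteq> v"
  from nonempty_sides obtain h1 where "h1 \<in> B"
    by blast
  with assms disjoint_sides have h1: "h1 \<in> A \<union> B" "h1 \<noteq> h0" "h1 \<notin> A"
    by auto
  have h0: "h0 \<in> A \<union> B"
    using assms by simp
  have self: "graph_dist P x x = 0" if "x \<in> pverts P" for x
    using that graph_dist_P by (cases x) (auto simp: pverts_P)
  consider "u \<in> ?S" | "v \<in> ?S" | "u \<notin> ?S" "v \<notin> ?S"
    by blast
  then show "\<exists>w\<in>?S. strongly_resolves P w u v"
  proof cases
    case 1
    with uv self show ?thesis
      by (intro bexI[of _ u]) (simp_all add: strongly_resolves_def)
  next
    case 2
    with uv self show ?thesis
      by (intro bexI[of _ v]) (simp_all add: strongly_resolves_def)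
  next
    case 3
    with uv obtain g g' where u: "u = (g, h0)" and v: "v = (g', h0)"
      and g: "g \<in> pverts G" "g' \<in> pverts G" "g \<noteq> g'"
      by (auto simp: pverts_P)
    show ?thesis
    proof (cases "(g, g') \<in> parcs G")
      case True
      (* 5 = 1 + 4 *)
      then have "strongly_resolves P (g, h1) u v"
        using g h0 h1 assms arc_sym no_loop
        by (auto simp: strongly_resolves_def u v graph_dist_P)
      with g h1 show ?thesis by blast
    next
      case False
      with g obtain b c where b: "(g', b) \<in> parcs G" "(b, c) \<in> parcs G" "(c, g) \<in> parcs G"
        using opposite_vertices by metis
      then have "(b, g) \<notin> parcs G"
        using no_triangle arc_sym by blast
      moreover have "(b, g') \<in> parcs G" "b \<in> pverts G" "b \<noteq> g" "(g', g) \<notin> parcs G"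
        using b False arc_sym wellformed' by blast+
      (* 3 = 1 + 2 *)
      ultimately have "strongly_resolves P (b, h1) u v"
        using g h0 h1 assms False
        by (auto simp: strongly_resolves_def u v graph_dist_P)
      with \<open>b \<in> pverts G\<close> h1 show ?thesis by blast
    qed
  qed
qed

lemma strong_metric_dim_P: "strong_metric_dim P = card (pverts G) * (card (A \<union> B) - 1)"
proof -
  from nonempty_sides obtain h0 where "h0 \<in> A"
    by blast
  then have "\<exists>S. strong_metric_generator P S \<and> card S = card (pverts G) * (card (A \<union> B) - 1)"
    using generator_without_layer finite_sides
    by (intro exI[of _ "pverts G \<times> (A \<union> B - {h0})"]) (auto simp: card_cartesian_product)
  then show ?thesis
    unfolding strong_metric_dim_def using generator_card_ge by (intro Least_equality) auto
qed

end

theorem theorem13: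
  fixes G :: "'a pair_pre_digraph" and H :: "'b pair_pre_digraph" and n k l :: nat
  assumes "pair_graph G"
    and "card (pverts G) = n" and "n \<ge> 2"
    and "\<not> bipartite_graph G"
    and "triangle_free G"
    and "C5_connected G"
    and "k \<ge> 1" and "l \<ge> 1" and "max k l \<ge> 2"
    and "complete_bipartite_digraph k l (with_proj H)"
  shows "strong_metric_dim (direct_product G H) = n * (k + l - 1)"
proof -
  from assms(10) obtain A B where AB: "finite (pverts H)" "pverts H = A \<union> B" "A \<inter> B = {}"
      "card A = k" "card B = l" "parcs H = A \<times> B \<union> B \<times> A"
    unfolding complete_bipartite_digraph_pair_def by blast
  interpret pair_graph G
    by (rule assms(1))
  interpret pentagonal_product G H A B
    using AB assms(2,3,5-8) by unfold_locales auto
  have "card (A \<union> B) = k + l"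
    using AB by (simp add: card_Un_disjoint)
  with strong_metric_dim_P assms(2) show ?thesis
    by simp
qed

end
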